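(* Let $K\le N$ and $\mathcal X\subseteq\mathcal C^N$. Assume that $F=G_y(A\,\cdot)$ satisfies (BRSC) with respect to $\Psi$, $\mathcal X$, $K$, with constant $C_K>0$. Let $x\in\mathcal X$ be a critical point of $J_\Psi$ such that, for every $i=1,\dots,N$, $$|z_i|\notin\left[C_K(\psi_i'(\alpha_i)-\psi_i'(0))+\psi_i'(0),\ \frac{\psi_i'(\alpha_i)-\psi_i'(0)}{C_K}+\psi_i'(0)\right],$$ where $z:=\nabla\Psi(x)-A^T\nabla G_y(Ax)$ (the interval being empty when its left end exceeds its right end). Then any other critical point $x'\in\mathcal C^N$ of $J_\Psi$, $x'\ne x$, satisfies $\|x'-x\|_0>K$.
   Context: Setting. $\mathcal C\in\{\mathbb R,\mathbb R_{\ge0}\}$, $A\in\mathbb R^{M\times N}$, $\mathcal Y\subset\mathbb R$, $y\in\mathcal Y^M$, $\lambda_0>0$; $\|x\|_0$ is the number of nonzero entries of $x$. Data term. $G_y(w)=\sum_{j=1}^Mg_{y_j}(w_j)$ on $\operatorname{dom}G_y=\prod_j\operatorname{dom}g_{y_j}$, where each $g_{y_j}$ is nonnegative, proper, strictly convex, coercive, twice differentiable on $\operatorname{int}(\operatorname{dom}g_{y_j})$, with $L$-Lipschitz derivative ($L>0$). If $\operatorname{dom}G_y\ne\mathbb R^M$, moreover $\operatorname{cl}(A\mathcal C^N)\subseteq\operatorname{int}(\operatorname{dom}G_y)$ and $\sup_{w\in A\mathcal C^N}\|\nabla G_y(w)\|<\infty$, where $A\mathcal C^N=\{Ax:x\in\mathcal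 C^N\}$. $F(x):=G_y(Ax)$. Generating function. $\Psi(x)=\sum_{i=1}^N\psi_i(x_i)$ on $\mathcal C^N$, where each $\psi_i$ has $\mathcal C\subseteq\operatorname{dom}\psi_i$ (more precisely $\mathcal C^N\subseteq\operatorname{int}(\operatorname{dom}F)\cap\operatorname{int}(\operatorname{dom}\Psi)$, so gradients make sense on $\mathcal C^N$), is proper, strictly convex, twice differentiable on $\operatorname{int}(\mathcal C)$, $x\mapsto\psi_i'(x)x-\psi_i(x)$ is coercive, and $\psi_i'$ is odd if $\mathcal C=\mathbb R$, while $\psi_i'(0)\ge0$ if $\mathcal C=\mathbb R_{\ge0}$. With $d_{\psi_i}(x,x')=\psi_i(x)-\psi_i(x')-\psi_i'(x')(x-x')$, $\alpha_i>0$ is defined by $\{t\in\mathcal C:d_{\psi_i}(0,t)\le\lambda_0\}=[-\alpha_i,\alpha_i]\cap\mathcal C$. Relaxation. $B_\Psi(x)=\sum_i\beta_{\psi_i}(x_i)$ with $\beta_{\psi_i}(x)=\psi_i(0)-\psi_i(x)+\operatorname{sign}(x)\psi_i'(\alpha_i)x$ if $|x|\le\alpha_i$ and $\beta_{\psi_i}(x)=\lambda_0$ if $|x|>\alpha_i$ ($x\in\mathcal C$). $J_\Psi(x):=G_y(Ax)+B_\Psi(x)$ on $\mathcal C^N$. Critical points. $\mathcal H:=B_\Psi+\Psi$ is convex on $\mathcal C^N$; $x\in\mathcal C^N$ is a critical point of $J_\Psi$ iff $\nabla\Psi(x)-A^T\nabla G_y(Ax)\in\partial\mathcal H(x)$,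 where $\partial\mathcal H$ is the convex subdifferential of $\mathcal H:\mathcal C^N\to\mathbb R$ (i.e. $v\in\partial\mathcal H(x)$ iff $\mathcal H(x')\ge\mathcal H(x)+\langle v,x'-x\rangle$ for all $x'\in\mathcal C^N$). (BRSC). $D_H^{\mathrm{symm}}(x,x')=\langle\nabla H(x')-\nabla H(x),x'-x\rangle$. $F$ satisfies (BRSC) with respect to $\Psi$, $\mathcal X$, $K$ with constant $C_K>0$ if $D_F^{\mathrm{symm}}(x,x')\ge C_KD_\Psi^{\mathrm{symm}}(x,x')$ for all $x\in\mathcal X$, $x'\in\mathcal C^N$ with $x'\ne x$, $\|x-x'\|_0\le K$. *)

theory Defs
  imports "HOL-Analysis.Analysis"
begin

definition edom :: "('a \<Rightarrow> ereal) \<Rightarrow> 'a set" where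
  "edom f = {x. f x \<noteq> \<infinity>}"

definition proper :: "('a \<Rightarrow> ereal) \<Rightarrow> bool" where
  "proper f \<longleftrightarrow> edom f \<noteq> {} \<and> (\<forall>x. f x \<noteq> -\<infinity>)"

text \<open>The strict inequality also forces \<^term>\<open>edom f\<close> to be convex.\<close>

definition strictly_convex :: "('a::real_vector \<Rightarrow> ereal) \<Rightarrow> bool" where
  "strictly_convex f \<longleftrightarrow>
     (\<forall>x\<in>edom f. \<forall>y\<in>edom f. \<forall>t::real. x \<noteq> y \<and> 0 < t \<and> t < 1 \<longrightarrow>
        f ((1 - t) *\<^sub>R x + t *\<^sub>R y) < ereal (1 - t) * f x + ereal t * f y)"

definition coercive_on :: "'a::real_normed_vector set \<Rightarrow> ('a \<Rightarrow> ereal) \<Rightarrow> bool" where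
  "coercive_on S f \<longleftrightarrow> (f \<longlongrightarrow> \<infinity>) (inf at_infinity (principal S))"

text \<open>Finite values and derivatives. They are meaningful on \<^term>\<open>edom f\<close> and at
  interior points of \<^term>\<open>edom f\<close> respectively, provided \<^term>\<open>f\<close> is proper
  (\<^const>\<open>real_of_ereal\<close> sends infinite values to 0).\<close>

definition val :: "('a \<Rightarrow> ereal) \<Rightarrow> 'a \<Rightarrow> real" where
  "val f x = real_of_ereal (f x)"

definition ederiv :: "(real \<Rightarrow> ereal) \<Rightarrow> real \<Rightarrow> real" where
  "ederiv f = deriv (val f)"

definition grad :: "('a::real_inner \<Rightarrow> ereal) \<Rightarrow> 'a \<Rightarrow> 'a" where
  "grad f x = (THE D. GDERIV (val f) x :> D)"

definition twice_differentiable_on :: "(real \<Rightarrow> ereal) \<Rightarrow> real set \<Rightarrow> bool" where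
  "twice_differentiable_on f S \<longleftrightarrow>
     (\<forall>t\<in>S. val f differentiable (at t) \<and> ederiv f differentiable (at t))"

definition cart_power :: "real set \<Rightarrow> (real ^ 'n) set" where
  "cart_power C = {x. \<forall>i. x $ i \<in> C}"

definition l0norm :: "real ^ 'n \<Rightarrow> nat" where
  "l0norm x = card {i. x $ i \<noteq> 0}"

definition data_term :: "(real \<Rightarrow> real \<Rightarrow> ereal) \<Rightarrow> real ^ 'm \<Rightarrow> real ^ 'm \<Rightarrow> ereal" where
  "data_term g y w = (\<Sum>j\<in>UNIV. g (y $ j) (w $ j))"

definition generating_fun :: "('n \<Rightarrow> real \<Rightarrow> ereal) \<Rightarrow> real ^ 'n \<Rightarrow> ereal" where
  "generating_fun \<psi> x = (\<Sum>i\<in>UNIV. \<psi> i (x $ i))"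

definition bregman :: "(real \<Rightarrow> ereal) \<Rightarrow> real \<Rightarrow> real \<Rightarrow> real" where
  "bregman f s t = val f s - val f t - ederiv f t * (s - t)"

definition threshold :: "real set \<Rightarrow> real \<Rightarrow> (real \<Rightarrow> ereal) \<Rightarrow> real" where
  "threshold C lam0 f =
     (THE a. 0 < a \<and> {t\<in>C. bregman f 0 t \<le> lam0} = {-a..a} \<inter> C)"

definition relax1 :: "real set \<Rightarrow> real \<Rightarrow> (real \<Rightarrow> ereal) \<Rightarrow> real \<Rightarrow> real" where
  "relax1 C lam0 f t =
     (let a = threshold C lam0 f in
      if \<bar>t\<bar> \<le> a then val f 0 - val f t + sgn t * ederiv f a * t else lam0)"

definition relaxation ::
    "real set \<Rightarrow> real \<Rightarrow> ('n \<Rightarrow> real \<Rightarrow> ereal) \<Rightarrow> real ^ 'n \<Rightarrow> real" where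
  "relaxation C lam0 \<psi> x = (\<Sum>i\<in>UNIV. relax1 C lam0 (\<psi> i) (x $ i))"

definition subdifferential_on ::
    "'a::real_inner set \<Rightarrow> ('a \<Rightarrow> real) \<Rightarrow> 'a \<Rightarrow> 'a set" where
  "subdifferential_on S h x = {v. \<forall>x'\<in>S. h x' \<ge> h x + v \<bullet> (x' - x)}"

definition dual_point ::
    "real ^ 'n ^ 'm \<Rightarrow> (real \<Rightarrow> real \<Rightarrow> ereal) \<Rightarrow> real ^ 'm \<Rightarrow>
     ('n \<Rightarrow> real \<Rightarrow> ereal) \<Rightarrow> real ^ 'n \<Rightarrow> real ^ 'n" where
  "dual_point A g y \<psi> x =
     grad (generating_fun \<psi>) x - transpose A *v grad (data_term g y) (A *v x)"

text \<open>Critical points of \<open>J = G\<^sub>y(A \<cdot>) + B\<close> on \<open>C\<^sup>N\<close>, with \<open>B\<close> the relaxation, in the sense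
  of the splitting \<open>J = (G\<^sub>y(A \<cdot>) - \<Psi>) + (B + \<Psi>)\<close>, whose first part is differentiable and
  whose second part is convex on \<open>C\<^sup>N\<close>.\<close>

definition critical_point ::
    "real set \<Rightarrow> real ^ 'n ^ 'm \<Rightarrow> (real \<Rightarrow> real \<Rightarrow> ereal) \<Rightarrow> real ^ 'm \<Rightarrow> real \<Rightarrow>
     ('n \<Rightarrow> real \<Rightarrow> ereal) \<Rightarrow> real ^ 'n \<Rightarrow> bool" where
  "critical_point C A g y lam0 \<psi> x \<longleftrightarrow>
     x \<in> cart_power C \<and>
     dual_point A g y \<psi> x \<in>
       subdifferential_on (cart_power C)
         (\<lambda>u. relaxation C lam0 \<psi> u + val (generating_fun \<psi>) u) x"

definition symm_bregman :: "('a::real_inner \<Rightarrow> ereal) \<Rightarrow> 'a \<Rightarrow> 'a \<Rightarrow> real" where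
  "symm_bregman H x x' = (grad H x' - grad H x) \<bullet> (x' - x)"

definition BRSC ::
    "real set \<Rightarrow> (real ^ 'n \<Rightarrow> ereal) \<Rightarrow> (real ^ 'n \<Rightarrow> ereal) \<Rightarrow> (real ^ 'n) set \<Rightarrow>
     nat \<Rightarrow> real \<Rightarrow> bool" where
  "BRSC C F \<Psi> X K c \<longleftrightarrow>
     0 < c \<and>
     (\<forall>x\<in>X. \<forall>x'\<in>cart_power C. x' \<noteq> x \<and> l0norm (x - x') \<le> K \<longrightarrow>
        symm_bregman F x x' \<ge> c * symm_bregman \<Psi> x x')"

end

theory Submission
  imports Defs
begin

text \<open>
  Both \<open>\<Psi>\<close> and the convex function \<open>B + \<Psi>\<close> are separable, so the components of the dual
  points \<open>z\<close>, \<open>z'\<close> of two critical points \<open>x\<close>, \<open>x'\<close> are one-dimensional subgradients: with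
  \<open>p = \<psi>'(\<alpha>)\<close>, \<open>z\<^sub>i\<close> equals \<open>p\<close> on \<open>(0, \<alpha>]\<close> and \<open>\<psi>'(x\<^sub>i)\<close> beyond \<open>\<alpha>\<close>, symmetrically for negative
  \<open>x\<^sub>i\<close>, and is at most \<open>p\<close> at \<open>0\<close>. For \<open>C\<^sub>K \<le> 1\<close>, if \<open>\<bar>z\<^sub>i\<bar>\<close>
  avoids the forbidden interval, then either \<open>x\<^sub>i = 0\<close>
  or \<open>\<bar>x\<^sub>i\<bar> > \<alpha>\<close>, with enough margin to give
  \<open>(z'\<^sub>i - z\<^sub>i)(x'\<^sub>i - x\<^sub>i) > (1 - C\<^sub>K)(\<psi>'(x'\<^sub>i) - \<psi>'(x\<^sub>i))(x'\<^sub>i - x\<^sub>i)\<close> whenever \<open>x'\<^sub>i \<noteq> x\<^sub>i\<close>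
  (for \<open>C\<^sub>K > 1\<close> the left side is nonnegative and the right side negative). Since the dual point is the gradient of
  \<open>\<Psi> - F\<close>, summing over \<open>i\<close> shows that the symmetric Bregman distance of \<open>F\<close> is less than \<open>C\<^sub>K\<close>
  times that of \<open>\<Psi>\<close>, which contradicts (BRSC) as soon as \<open>x' - x\<close> has at most \<open>K\<close> nonzero entries.
\<close>

section \<open>Separable extended-real sums: finiteness, domains and gradients\<close>

lemma edom_sum_component:
  fixes f :: "'n::finite \<Rightarrow> real \<Rightarrow> ereal"
  assumes "\<And>i. proper (f i)" and "(\<Sum>i\<in>UNIV. f i (x $ i)) \<noteq> \<infinity>"
  shows "\<bar>f i (x $ i)\<bar> \<noteq> \<infinity>"
  using assms by (auto simp: sum_Pinfty proper_def)

lemma val_separable_sum: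
  fixes f :: "'n::finite \<Rightarrow> real \<Rightarrow> ereal"
  assumes "\<And>i. proper (f i)" and "x \<in> edom (\<lambda>x. \<Sum>i\<in>UNIV. f i (x $ i))"
  shows "val (\<lambda>x. \<Sum>i\<in>UNIV. f i (x $ i)) x = (\<Sum>i\<in>UNIV. val (f i) (x $ i))"
proof -
  have "\<bar>f i (x $ i)\<bar> \<noteq> \<infinity>" for i
    by (rule edom_sum_component) (use assms in \<open>auto simp: edom_def\<close>)
  then show ?thesis
    by (simp add: val_def sum_real_of_ereal)
qed

text \<open>Moving only coordinate \<open>i\<close> by less than \<open>e\<close> stays in the ball
  around \<open>x\<close>, so \<open>f i\<close> is finite on an interval around
  \<open>x $ i\<close>.\<close>

lemma interior_edom_component:
  fixes f :: "'n::finite \<Rightarrow> real \<Rightarrow> ereal"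
  assumes "\<And>i. proper (f i)" and "x \<in> interior (edom (\<lambda>x. \<Sum>i\<in>UNIV. f i (x $ i)))"
  shows "x $ i \<in> interior (edom (f i))"
proof -
  obtain e where e: "e > 0" "ball x e \<subseteq> edom (\<lambda>x. \<Sum>i\<in>UNIV. f i (x $ i))"
    using assms(2) by (auto simp: mem_interior)
  have "t \<in> edom (f i)" if t: "t \<in> ball (x $ i) e" for t
  proof -
    define u where "u = x + axis i (t - x $ i)"
    have "dist x u = \<bar>t - x $ i\<bar>"
      by (simp add: u_def dist_norm norm_eq_sqrt_inner inner_axis_axis)
    then have "u \<in> edom (\<lambda>x. \<Sum>i\<in>UNIV. f i (x $ i))"
      using t e by (auto simp: dist_real_def)
    then have "\<bar>f i (u $ i)\<bar> \<noteq> \<infinity>"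
      by (intro edom_sum_component[OF assms(1)]) (auto simp: edom_def)
    then show ?thesis
      by (auto simp: u_def edom_def)
  qed
  then show ?thesis
    using e(1) by (auto simp: mem_interior)
qed

lemma GDERIV_unique: "GDERIV f x :> D \<Longrightarrow> GDERIV f x :> E \<Longrightarrow> D = E"
  unfolding gderiv_def by (metis has_derivative_unique inner_commute vector_eq_rdot)

lemma grad_eqI: "GDERIV (val f) x :> D \<Longrightarrow> grad f x = D"
  unfolding grad_def by (blast intro: GDERIV_unique)

lemma has_ederiv:
  "val f differentiable (at t) \<Longrightarrow> (val f has_real_derivative ederiv f t) (at t)"
  unfolding ederiv_def using DERIV_deriv_iff_real_differentiable by blast

text \<open>Exchanging \<open>val\<close> with the sum is justified on the domain, where no infinite
  summand is sent to 0. Its interior is an open neighbourhood of \<open>x\<close>, so the derivative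
  transfers.\<close>

lemma GDERIV_separable_sum:
  fixes f :: "'n::finite \<Rightarrow> real \<Rightarrow> ereal"
  assumes "\<And>i. proper (f i)" and x: "x \<in> interior (edom (\<lambda>x. \<Sum>i\<in>UNIV. f i (x $ i)))"
    and diff: "\<And>i. val (f i) differentiable (at (x $ i))"
  shows "GDERIV (val (\<lambda>x. \<Sum>i\<in>UNIV. f i (x $ i))) x :> (\<chi> i. ederiv (f i) (x $ i))"
proof -
  have "((\<lambda>x. val (f i) (x $ i)) has_derivative (\<lambda>h. ederiv (f i) (x $ i) * (h $ i))) (at x)" for i
  proof -
    have "(val (f i) has_derivative (*) (ederiv (f i) (x $ i))) (at (x $ i))"
      using has_ederiv[OF diff] by (simp add: has_field_derivative_def)
    moreover have "((\<lambda>x. x $ i) has_derivative (\<lambda>h. h $ i)) (at x)"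
      by (intro bounded_linear_imp_has_derivative bounded_linear_vec_nth)
    ultimately show ?thesis
      using has_derivative_compose by blast
  qed
  then have "((\<lambda>x. \<Sum>i\<in>UNIV. val (f i) (x $ i)) has_derivative
      (\<lambda>h. \<Sum>i\<in>UNIV. ederiv (f i) (x $ i) * (h $ i))) (at x)"
    by (intro has_derivative_sum) auto
  then have "(val (\<lambda>x. \<Sum>i\<in>UNIV. f i (x $ i)) has_derivative
      (\<lambda>h. \<Sum>i\<in>UNIV. ederiv (f i) (x $ i) * (h $ i))) (at x)"
    by (rule has_derivative_transform_within_open[OF _ open_interior x])
      (use assms(1) interior_subset in \<open>fastforce simp: val_separable_sum\<close>)
  then show ?thesis
    by (simp add: gderiv_def inner_vec_def mult.commute)
qed

lemma GDERIV_compose_matrix: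
  fixes A :: "real ^ 'n ^ 'm"
  assumes "GDERIV G (A *v x) :> D"
  shows "GDERIV (\<lambda>u. G (A *v u)) x :> transpose A *v D"
proof -
  have "((\<lambda>u. A *v u) has_derivative (\<lambda>h. A *v h)) (at x)"
    by (intro bounded_linear_imp_has_derivative matrix_vector_mul_bounded_linear)
  from has_derivative_compose[OF this assms[unfolded gderiv_def]]
  show ?thesis
    by (simp add: gderiv_def inner_commute[of _ "D v* A"] dot_lmul_matrix inner_commute[of _ D])
qed

section \<open>One generating function: tangent inequality, increasing derivative, symmetry\<close>

locale generator =
  fixes C :: "real set" and lam0 :: real and f :: "real \<Rightarrow> ereal"
  assumes C: "C = UNIV \<or> C = {0..}"
    and lam0: "lam0 > 0"
    and dom: "C \<subseteq> edom f"
    and f_proper: "proper f"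
    and convex: "strictly_convex f"
    and diff: "\<And>t. t \<in> C \<Longrightarrow> val f differentiable (at t)"
    and diff2: "twice_differentiable_on f (interior C)"
    and coercive: "coercive_on C (\<lambda>t. ereal (ederiv f t * t - val f t))"
    and odd: "\<And>t. C = UNIV \<Longrightarrow> ederiv f (- t) = - ederiv f t"
    and deriv_0: "C = {0..} \<Longrightarrow> ederiv f 0 \<ge> 0"
begin

lemma nonneg_mem: "0 \<le> t \<Longrightarrow> t \<in> C"
  using C by auto

lemma neg_mem: "t \<in> C \<Longrightarrow> t < 0 \<Longrightarrow> C = UNIV"
  using C by auto

lemma has_deriv: "t \<in> C \<Longrightarrow> (val f has_real_derivative ederiv f t) (at t)"
  by (rule has_ederiv[OF diff])

lemma deriv_0_nonneg: "ederiv f 0 \<ge> 0"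
  using C deriv_0 odd[of 0] by auto

lemma val_strictly_convex:
  assumes "s \<in> C" "t \<in> C" "s \<noteq> t" "0 < u" "u < 1"
  shows "val f (s + u * (t - s)) < val f s + u * (val f t - val f s)"
proof -
  define m where "m = (1 - u) *\<^sub>R s + u *\<^sub>R t"
  have m: "m = s + u * (t - s)"
    by (simp add: m_def algebra_simps)
  have lt: "f m < ereal (1 - u) * f s + ereal u * f t"
    using convex assms dom unfolding strictly_convex_def m_def by blast
  have fin: "f s = ereal (val f s)" "f t = ereal (val f t)"
    using assms dom f_proper
    by (auto simp: val_def proper_def edom_def ereal_real subset_eq)
  have "f m \<noteq> \<infinity>"
    using lt by auto
  then have "f m = ereal (val f m)"
    using f_proper by (auto simp: val_def proper_def ereal_real)
  then show ?thesis
    using lt unfolding fin m by (simp add: algebra_simps)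
qed

text \<open>Otherwise \<open>f\<close> minus its chord, parametrised by \<open>u\<close> from
  \<open>s\<close> to \<open>t\<close>, has positive derivative at \<open>u = 0\<close> and so rises
  above the chord just after \<open>s\<close>, against convexity.\<close>

lemma deriv_le_slope:
  assumes "s \<in> C" "t \<in> C"
  shows "ederiv f s * (t - s) \<le> val f t - val f s"
proof (rule ccontr)
  assume neg: "\<not> ?thesis"
  then have ne: "s \<noteq> t" by auto
  define h where "h = (\<lambda>u. val f (s + u * (t - s)) - u * (val f t - val f s))"
  have h_deriv: "(h has_real_derivative (ederiv f s * (t - s) - (val f t - val f s))) (at 0)"
  proof -
    have "((\<lambda>u. s + u * (t - s)) has_real_derivative (t - s)) (at 0)"
      by (auto intro!: derivative_eq_intros)
    from DERIV_chain2[of "val f" "ederiv f s", OF _ this] has_deriv[OF assms(1)]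
    have "((\<lambda>u. val f (s + u * (t - s))) has_real_derivative ederiv f s * (t - s)) (at 0)"
      by simp
    then show ?thesis
      unfolding h_def by (auto intro!: derivative_eq_intros)
  qed
  have "0 < ederiv f s * (t - s) - (val f t - val f s)"
    using neg by simp
  from DERIV_pos_inc_right[OF h_deriv this]
  obtain d where d: "d > 0" "\<And>k. k > 0 \<Longrightarrow> k < d \<Longrightarrow> h 0 < h (0 + k)"
    by blast
  define k where "k = min (d / 2) (1 / 2)"
  have "k > 0" "k < d" "k < 1"
    using d(1) by (auto simp: k_def)
  with d(2) val_strictly_convex[OF assms ne, of k] show False
    by (force simp: h_def)
qed

text \<open>Strictness comes from the midpoint: the weak inequality holds there, while the value
  lies strictly below the chord.\<close>

lemma deriv_less_slope:
  assumes "s \<in> C" "t \<in> C" "s \<noteq> t"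
  shows "ederiv f s * (t - s) < val f t - val f s"
proof -
  define m where "m = s + (1 / 2) * (t - s)"
  have "m = (s + t) / 2"
    by (simp add: m_def field_simps)
  then have "m \<in> C"
    using C assms by auto
  then have "ederiv f s * (m - s) \<le> val f m - val f s"
    by (rule deriv_le_slope[OF assms(1)])
  moreover have "ederiv f s * (m - s) = ederiv f s * (t - s) / 2"
    by (simp add: m_def)
  moreover have "val f m < val f s + (1 / 2) * (val f t - val f s)"
    unfolding m_def using assms by (intro val_strictly_convex) auto
  ultimately show ?thesis by argo
qed

lemma deriv_strict_mono:
  assumes "s \<in> C" "t \<in> C" "s < t"
  shows "ederiv f s < ederiv f t"
proof -
  have "ederiv f s * (t - s) < ederiv f t * (t - s)"
    using deriv_less_slope[of s t] deriv_less_slope[of t s] assms by (auto simp: algebra_simps)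
  then show ?thesis
    using assms(3) by simp
qed

text \<open>The odd derivative makes \<open>val f t - val f (- t)\<close> constant, and it vanishes
  at 0.\<close>

lemma val_even:
  assumes "C = UNIV"
  shows "val f (- t) = val f t"
proof -
  have "((\<lambda>t. val f t - val f (- t)) has_real_derivative 0) (at t)" for t
  proof -
    have "((\<lambda>t. val f (- t)) has_real_derivative ederiv f (- t) * (- 1)) (at t)"
      by (rule DERIV_chain2[where f = "val f"])
        (use has_deriv assms in \<open>auto intro!: derivative_eq_intros\<close>)
    from DERIV_diff[OF has_deriv this] show ?thesis
      using odd assms by simp
  qed
  then have "val f t - val f (- t) = val f 0 - val f (- 0)"
    by (intro DERIV_isconst_all[of "\<lambda>t. val f t - val f (- t)"]) blast
  then show ?thesis by simp
qed

section \<open>The threshold as the positive solution of \<open>bregman f 0 t = lam0\<close>\<close>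

lemma bregman_even: "C = UNIV \<Longrightarrow> bregman f 0 (- t) = bregman f 0 t"
  by (simp add: bregman_def val_even odd)

text \<open>By the tangent inequality at \<open>t\<close>, the increment exceeds
  \<open>(ederiv f t - ederiv f s) * s\<close>, which is nonnegative as the derivative
  increases.\<close>

lemma bregman_strict_mono:
  assumes "0 \<le> s" "s < t"
  shows "bregman f 0 s < bregman f 0 t"
proof -
  have "ederiv f t * (s - t) < val f s - val f t" "ederiv f s < ederiv f t"
    using assms by (auto intro!: deriv_less_slope deriv_strict_mono nonneg_mem)
  moreover from this(2) have "ederiv f s * s \<le> ederiv f t * s"
    using assms by (intro mult_right_mono) auto
  ultimately show ?thesis
    by (simp add: bregman_def algebra_simps)
qed

lemma bregman_small: "\<exists>t>0. bregman f 0 t < lam0"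
proof -
  \<comment> \<open>For \<open>C = {0..}\<close>, \<open>diff2\<close> says nothing about
    \<open>ederiv f\<close> at 0. Replacing \<open>ederiv f t\<close> by the larger
    \<open>ederiv f 1\<close> on (0,1) gives a majorant that is continuous and zero at 0.\<close>
  define h where "h = (\<lambda>t. val f 0 - val f t + ederiv f 1 * t)"
  have "isCont h 0"
    unfolding h_def using DERIV_isCont[OF has_deriv[OF nonneg_mem[of 0]]]
    by (auto intro!: continuous_intros)
  then have "(h \<longlongrightarrow> 0) (at 0)"
    by (simp add: isCont_def h_def)
  then have "\<forall>\<^sub>F t in at 0. h t < lam0"
    using lam0 order_tendstoD(2) by blast
  then have "\<forall>\<^sub>F t in at_right 0. h t < lam0"
    by (metis (no_types, lifting) at_le eventually_mono filter_leD subset_UNIV)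
  moreover have "\<forall>\<^sub>F t in at_right (0::real). 0 < t \<and> t < 1"
    by (auto simp: eventually_at_right_field intro!: exI[of _ 1])
  ultimately have "\<forall>\<^sub>F t in at_right (0::real). h t < lam0 \<and> 0 < t \<and> t < 1"
    by (auto elim: eventually_elim2)
  then obtain t where t: "h t < lam0" "0 < t" "t < 1"
    using eventually_happens[of _ "at_right (0::real)"] by auto
  moreover have "ederiv f t * t \<le> ederiv f 1 * t"
    using t deriv_strict_mono[of t 1] nonneg_mem by (intro mult_right_mono) auto
  ultimately have "bregman f 0 t < lam0"
    unfolding bregman_def h_def by (simp only: algebra_simps)
  then show ?thesis using t by auto
qed

lemma bregman_large: "\<exists>t\<ge>u. bregman f 0 t > lam0"
proof -
  have "\<forall>\<^sub>F t in inf at_infinity (principal C).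
      ereal (ederiv f t * t - val f t) > ereal (lam0 - val f 0)"
    using coercive unfolding coercive_on_def by (rule order_tendstoD) auto
  then obtain b where b: "\<And>t. norm t \<ge> b \<Longrightarrow> t \<in> C \<Longrightarrow> ederiv f t * t - val f t > lam0 - val f 0"
    by (auto simp: eventually_inf_principal eventually_at_infinity)
  \<comment> \<open>Nonnegative to lie in \<open>C\<close>, at least \<open>b\<close> for
    coercivity, at least \<open>u\<close> as required.\<close>
  define t where "t = max u (max 0 b)"
  have "ederiv f t * t - val f t > lam0 - val f 0"
    by (rule b) (auto simp: t_def intro: nonneg_mem)
  then show ?thesis
    by (intro exI[of _ t]) (auto simp: bregman_def t_def)
qed

lemma bregman_eq_ex: "\<exists>a>0. bregman f 0 a = lam0"
proof -
  obtain s where s: "s > 0" "bregman f 0 s < lam0"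
    using bregman_small by auto
  obtain t where t: "t \<ge> s" "bregman f 0 t > lam0"
    using bregman_large by auto
  \<comment> \<open>Starting at \<open>s > 0\<close> keeps the intermediate value argument inside
    \<open>interior C\<close>, where \<open>ederiv f\<close> is continuous.\<close>
  have "isCont (bregman f 0) u" if "s \<le> u" for u
  proof -
    have "u \<in> interior C"
      using C that s by (auto simp: interior_real_atLeast)
    then have "isCont (ederiv f) u"
      using diff2 unfolding twice_differentiable_on_def
      by (auto intro: differentiable_imp_continuous_within)
    moreover have "isCont (val f) u"
      using DERIV_isCont[OF has_deriv[OF nonneg_mem]] that s by auto
    ultimately show ?thesis
      unfolding bregman_def by (auto intro!: continuous_intros)
  qed
  with IVT[of "bregman f 0" s lam0 t] s t obtain b where "s \<le> b" "bregman f 0 b = lam0"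
    by auto
  with s show ?thesis
    by (intro exI[of _ b]) simp
qed

definition a where "a = threshold C lam0 f"

abbreviation p where "p \<equiv> ederiv f a"
abbreviation q where "q \<equiv> ederiv f 0"

lemma threshold_pos_eq: "0 < a \<and> bregman f 0 a = lam0"
proof -
  obtain b where b: "b > 0" "bregman f 0 b = lam0"
    using bregman_eq_ex by auto
  have nonneg: "bregman f 0 t \<le> lam0 \<longleftrightarrow> t \<le> b" if "0 \<le> t" for t
    using bregman_strict_mono[of t b] bregman_strict_mono[of b t] that b by force
  have "bregman f 0 t \<le> lam0 \<longleftrightarrow> - b \<le> t \<and> t \<le> b" if "t \<in> C" for t
  proof (cases "0 \<le> t")
    case True
    then show ?thesis using nonneg b by auto
  next
    case False
    then have "bregman f 0 t = bregman f 0 (- t)"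
      using neg_mem that by (simp add: bregman_even)
    then show ?thesis using nonneg[of "- t"] False b by auto
  qed
  then have eq: "{t\<in>C. bregman f 0 t \<le> lam0} = {-b..b} \<inter> C"
    by auto
  have "a = b"
    unfolding a_def threshold_def
  proof (rule the_equality)
    show "0 < b \<and> {t\<in>C. bregman f 0 t \<le> lam0} = {-b..b} \<inter> C"
      using b eq by simp
    fix c assume c: "0 < c \<and> {t\<in>C. bregman f 0 t \<le> lam0} = {-c..c} \<inter> C"
    then have "{-b..b} \<inter> C = {-c..c} \<inter> C"
      using eq by simp
    \<comment> \<open>Both right ends are positive and hence in \<open>C\<close>, so intersecting
      with \<open>C\<close> loses neither of them and the intervals determine them.\<close>
    moreover have "b \<in> {-b..b} \<inter> C" "c \<in> {-c..c} \<inter> C"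
      using b c by (simp_all add: nonneg_mem)
    ultimately have "b \<in> {-c..c}" "c \<in> {-b..b}" by blast+
    then show "c = b" by auto
  qed
  with b show ?thesis by simp
qed

lemma a_pos: "0 < a"
  using threshold_pos_eq by simp

lemma a_mem: "a \<in> C"
  using a_pos by (simp add: nonneg_mem)

lemma lam0_eq: "lam0 = val f 0 - val f a + p * a"
  using threshold_pos_eq by (simp add: bregman_def)

lemma q_less_p: "q < p"
  using deriv_strict_mono[OF nonneg_mem a_mem a_pos] by simp

text \<open>One summand of the convex function \<open>B + \<Psi>\<close>.\<close>

definition h where "h t = relax1 C lam0 f t + val f t"

text \<open>The \<open>- val f t\<close> in the relaxation cancels \<open>val f t\<close>, leaving a
  function linear on each side of 0.\<close>

lemma h_le: "\<bar>t\<bar> \<le> a \<Longrightarrow> h t = val f 0 + p * \<bar>t\<bar>"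
  by (auto simp: h_def relax1_def a_def[symmetric] Let_def sgn_if)

text \<open>At \<open>t = a\<close> the inner branch applies; it agrees with the outer one because
  \<open>lam0\<close> equals \<open>bregman f 0 a\<close>.\<close>

lemma h_ge: "t \<ge> a \<Longrightarrow> h t = lam0 + val f t"
  using h_le[of t] a_pos lam0_eq
  by (cases "t = a") (auto simp: h_def relax1_def a_def[symmetric] Let_def)

lemma h_even: "C = UNIV \<Longrightarrow> h (- t) = h t"
  unfolding h_def relax1_def Let_def a_def[symmetric] by (simp only: val_even sgn_minus) simp

section \<open>Subgradients of \<open>h\<close>, according to the position of the point\<close>

definition subdiff where "subdiff t = {z. \<forall>s\<in>C. h s \<ge> h t + z * (s - t)}"

lemma subdiff_uminus:
  assumes U: "C = UNIV" and z: "z \<in> subdiff t"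
  shows "- z \<in> subdiff (- t)"
  unfolding subdiff_def
proof safe
  fix s
  have "- s \<in> C" using U by blast
  then have "h t + z * (- s - t) \<le> h (- s)"
    using z unfolding subdiff_def by blast
  then show "h (- t) + - z * (s - - t) \<le> h s"
    unfolding h_even[OF U] by (simp add: algebra_simps)
qed

lemma subdiff_mono:
  assumes "z \<in> subdiff t" "w \<in> subdiff s" "s \<in> C" "t \<in> C"
  shows "(w - z) * (s - t) \<ge> 0"
proof -
  have "h s \<ge> h t + z * (s - t)" "h t \<ge> h s + w * (t - s)"
    using assms by (auto simp: subdiff_def)
  then show ?thesis by (simp add: algebra_simps)
qed

text \<open>Testing at \<open>a\<close> bounds \<open>z\<close> from above. There is no general
  lower bound: for \<open>C = {0..}\<close> no test point lies to the left of 0.\<close>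

lemma subdiff_0:
  assumes "z \<in> subdiff 0"
  shows "z \<le> p"
proof -
  have "h a \<ge> h 0 + z * (a - 0)"
    using assms a_mem unfolding subdiff_def by blast
  then have "z * a \<le> p * a"
    using h_le[of a] h_le[of 0] a_pos by simp
  then show ?thesis using a_pos by simp
qed

text \<open>Only test points to the right of \<open>t\<close> are used, which lets the bound include
  \<open>t = a\<close>, where \<open>h\<close> changes formula.\<close>

lemma subdiff_le_deriv:
  assumes "t \<ge> a" "z \<in> subdiff t"
  shows "z \<le> ederiv f t"
proof (rule ccontr)
  assume neg: "\<not> ?thesis"
  have tC: "t \<in> C" using assms a_pos by (auto intro: nonneg_mem)
  have "((\<lambda>s. val f s - z * s) has_real_derivative ederiv f t - z) (at t)"
    by (auto intro!: derivative_eq_intros has_deriv tC)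
  from DERIV_neg_dec_right[OF this] neg obtain d where d: "d > 0"
      "\<And>k. k > 0 \<Longrightarrow> k < d \<Longrightarrow> val f t - z * t > val f (t + k) - z * (t + k)"
    by auto
  have "t + d / 2 \<in> C"
    using assms d(1) a_pos by (intro nonneg_mem) auto
  then have "h (t + d / 2) \<ge> h t + z * (t + d / 2 - t)"
    using assms(2) unfolding subdiff_def by blast
  then have "val f (t + d / 2) \<ge> val f t + z * (d / 2)"
    using assms d(1) by (simp add: h_ge)
  with d(2)[of "d / 2"] d(1) show False
    by (simp add: algebra_simps)
qed

text \<open>Testing at 0 gives \<open>p \<le> z\<close>. Testing at \<open>a\<close> gives the
  converse for \<open>t < a\<close>; at \<open>t = a\<close> the derivative bound replaces
  it.\<close>

lemma subdiff_middle:
  assumes "0 < t" "t \<le> a" "z \<in> subdiff t"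
  shows "z = p"
proof (rule antisym)
  have "h 0 \<ge> h t + z * (0 - t)"
    using assms nonneg_mem[of 0] unfolding subdiff_def by blast
  then have "p * t \<le> z * t"
    using assms by (simp add: h_le)
  then show "p \<le> z" using assms by simp
  show "z \<le> p"
  proof (cases "t = a")
    case True
    then show ?thesis using subdiff_le_deriv assms by auto
  next
    case False
    have "h a \<ge> h t + z * (a - t)"
      using assms a_mem unfolding subdiff_def by blast
    then have "z * (a - t) \<le> p * (a - t)"
      using assms a_pos by (simp add: h_le algebra_simps)
    then show ?thesis using False assms by simp
  qed
qed

text \<open>Within distance \<open>t - a\<close> of \<open>t\<close>, \<open>h\<close> is
  \<open>val f\<close> plus a constant, so \<open>t\<close> locally minimises
  \<open>val f s - z * s\<close>.\<close>

lemma subdiff_large: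
  assumes "t > a" "z \<in> subdiff t"
  shows "z = ederiv f t"
proof -
  have tC: "t \<in> C" using assms a_pos by (auto intro: nonneg_mem)
  have "((\<lambda>s. val f s - z * s) has_real_derivative ederiv f t - z) (at t)"
    by (auto intro!: derivative_eq_intros has_deriv tC)
  moreover have "val f t - z * t \<le> val f s - z * s" if "\<bar>t - s\<bar> < t - a" for s
  proof -
    have "s > a" using that by auto
    then have "h s \<ge> h t + z * (s - t)"
      using assms a_pos nonneg_mem unfolding subdiff_def by auto
    then show ?thesis
      using \<open>s > a\<close> assms(1) by (simp add: h_ge algebra_simps)
  qed
  ultimately have "ederiv f t - z = 0"
    using assms(1) by (intro DERIV_local_min[where d = "t - a"]) auto
  then show ?thesis by simp
qed

section \<open>The strict one-dimensional estimate outside the forbidden interval\<close>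

context
  fixes c :: real
  assumes c: "0 < c" "c \<le> 1"
begin

text \<open>For \<open>c \<le> 1\<close> the interval contains \<open>p\<close>, the subgradient on
  \<open>(0, a]\<close>; this rules out such points.\<close>

lemma gap_ends: "q < c * (p - q) + q" "c * (p - q) + q \<le> p" "p \<le> (p - q) / c + q"
proof -
  have le: "c * (p - q) \<le> p - q"
    using c q_less_p by (intro mult_left_le_one_le) auto
  then show "c * (p - q) + q \<le> p" by simp
  show "q < c * (p - q) + q" using c q_less_p by simp
  have "p - q \<le> (p - q) / c"
    using le c by (simp add: pos_le_divide_eq mult.commute)
  then show "p \<le> (p - q) / c + q" by simp
qed

lemma subdiff_gap_0_pos:
  assumes s: "s > 0" and z: "z \<in> subdiff 0" and w: "w \<in> subdiff s"
    and gap: "\<bar>z\<bar> \<notin> {c * (p - q) + q .. (p - q) / c + q}"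
  shows "(w - z) * (s - 0) > (1 - c) * ((ederiv f s - q) * (s - 0))"
proof -
  \<comment> \<open>\<open>z\<close> is at most \<open>p\<close>, which lies in the interval, and
    the left end is positive; a \<open>z\<close> above the left end would be forbidden.\<close>
  have z_lt: "z < c * (p - q) + q"
    using subdiff_0[OF z] gap gap_ends deriv_0_nonneg by (auto simp: not_le)
  have "(1 - c) * (ederiv f s - q) < w - z"
  proof (cases "s \<le> a")
    case True
    then have "w = p" using subdiff_middle w s by blast
    moreover have "ederiv f s \<le> p"
      using True s deriv_strict_mono[of s a] a_mem nonneg_mem[of s] by (cases "s = a") auto
    then have "(1 - c) * (ederiv f s - q) \<le> (1 - c) * (p - q)"
      using c by (intro mult_left_mono) auto
    ultimately show ?thesis using z_lt by (simp add: algebra_simps)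
  next
    case False
    then have "w = ederiv f s" using subdiff_large w by simp
    moreover have "p < ederiv f s"
      using False s deriv_strict_mono[of a s] a_mem nonneg_mem[of s] by auto
    then have "c * (p - q) < c * (ederiv f s - q)"
      using c by simp
    ultimately show ?thesis using z_lt by (simp add: algebra_simps)
  qed
  then show ?thesis
    using mult_strict_right_mono[OF _ s, of "(1 - c) * (ederiv f s - q)" "w - z"]
    by (simp only: mult.assoc diff_zero)
qed

lemma subdiff_gap_pos:
  assumes s: "s \<in> C" and t: "t > 0" and ne: "s \<noteq> t"
    and z: "z \<in> subdiff t" and w: "w \<in> subdiff s"
    and gap: "\<bar>z\<bar> \<notin> {c * (p - q) + q .. (p - q) / c + q}"
  shows "(w - z) * (s - t) > (1 - c) * ((ederiv f s - ederiv f t) * (s - t))"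
proof -
  have tC: "t \<in> C" using t by (simp add: nonneg_mem)
  have pos: "0 < p" using deriv_0_nonneg q_less_p by simp
  have ta: "t > a"
    using subdiff_middle[OF t _ z] gap gap_ends pos by force
  then have zt: "z = ederiv f t" using subdiff_large z by simp
  have pz: "p < z" using zt ta deriv_strict_mono a_mem tC by simp
  then have "(p - q) / c + q < z" using gap gap_ends pos by auto
  \<comment> \<open>This is the margin from the right end of the interval, with the denominator
    cleared. It absorbs the worst case \<open>w = p\<close> when \<open>s\<close> lies in
    \<open>[-a, a]\<close>.\<close>
  then have cz: "p - q < c * (z - q)"
    using c by (simp add: field_simps)
  have conv: ?thesis if "s < t" "w - z < (1 - c) * (ederiv f s - ederiv f t)"
    using mult_strict_right_mono_neg[OF that(2), of "s - t"] that(1) by (simp add: mult.assoc)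
  \<comment> \<open>Beyond the threshold both subgradients are derivatives, so the two sides differ
    by \<open>c\<close> times a positive product.\<close>
  have same_branch: ?thesis if "w = ederiv f s"
  proof -
    have "(ederiv f s - ederiv f t) * (s - t) > 0"
      using ne deriv_strict_mono[OF s tC] deriv_strict_mono[OF tC s]
      by (cases "s < t") (auto simp: zero_less_mult_iff)
    then have "c * ((ederiv f s - ederiv f t) * (s - t)) > 0"
      using c by simp
    then show ?thesis using that zt by (simp add: algebra_simps)
  qed
  consider "s > a" | "0 \<le> s" "s \<le> a" | "s < 0" "- s \<le> a" | "s < 0" "- s > a" by linarith
  then show ?thesis
  proof cases
    case 1
    then show ?thesis using same_branch subdiff_large w by simp
  next
    case 2
    have "w \<le> p"
      using 2 subdiff_0 subdiff_middle[of s w] w by (cases "s = 0") auto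
    moreover have "q \<le> ederiv f s"
      using 2 deriv_strict_mono[of 0 s] s nonneg_mem[of 0] by (cases "s = 0") auto
    then have "(1 - c) * q \<le> (1 - c) * ederiv f s"
      using c by (intro mult_left_mono) auto
    ultimately show ?thesis
      using 2 ta cz zt by (intro conv) (auto simp: algebra_simps)
  next
    case 3
    have U: "C = UNIV" using neg_mem s 3 by simp
    then have q0: "q = 0" using odd[of 0] by simp
    have "- w = p"
      using 3 subdiff_middle[of "- s" "- w"] subdiff_uminus[OF U w] by simp
    moreover have "0 < ederiv f (- s)" "ederiv f (- s) \<le> p"
      using 3 U q0 deriv_strict_mono[of 0 "- s"] deriv_strict_mono[of "- s" a]
      by (simp, cases "- s = a") auto
    then have "(1 - c) * ederiv f (- s) \<le> p"
      using c mult_left_le_one_le[of "ederiv f (- s)" "1 - c"] by linarith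
    ultimately show ?thesis
      using 3 t cz zt q0 pos odd[OF U, of s] by (intro conv) (auto simp: algebra_simps)
  next
    case 4
    have U: "C = UNIV" using neg_mem s 4 by simp
    have "- w = ederiv f (- s)"
      using 4 subdiff_large[of "- s" "- w"] subdiff_uminus[OF U w] by simp
    then show ?thesis using same_branch odd[OF U] by simp
  qed
qed

end

text \<open>Negative points occur only for \<open>C = UNIV\<close>, where reflecting both points and
  both subgradients keeps the products and the gap condition, reducing to the positive
  cases.\<close>

lemma subdiff_gap:
  assumes s: "s \<in> C" and t: "t \<in> C" and ne: "s \<noteq> t"
    and z: "z \<in> subdiff t" and w: "w \<in> subdiff s" and c: "c > 0"
    and gap: "\<bar>z\<bar> \<notin> {c * (p - q) + q .. (p - q) / c + q}"
  shows "(w - z) * (s - t) > (1 - c) * ((ederiv f s - ederiv f t) * (s - t))"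
proof (cases "c \<le> 1")
  case False
  have "(ederiv f s - ederiv f t) * (s - t) > 0"
    using ne deriv_strict_mono[OF s t] deriv_strict_mono[OF t s]
    by (cases "s < t") (auto simp: zero_less_mult_iff)
  then have "(1 - c) * ((ederiv f s - ederiv f t) * (s - t)) < 0"
    using False by (simp add: mult_neg_pos)
  with subdiff_mono[OF z w s t] show ?thesis by linarith
next
  case True
  note reflect = subdiff_uminus[OF _ z] subdiff_uminus[OF _ w]
  have flip: "(- w - - z) * (- s - - t) = (w - z) * (s - t)"
    by (simp add: algebra_simps)
  consider "t > 0" | "t < 0" | "t = 0" "s > 0" | "t = 0" "s < 0" using ne by linarith
  then show ?thesis
  proof cases
    case 1
    then show ?thesis using subdiff_gap_pos[OF c True s _ ne z w gap] by simp
  next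
    case 2
    then have U: "C = UNIV" using neg_mem t by simp
    have "(1 - c) * ((ederiv f (- s) - ederiv f (- t)) * (- s - - t)) < (- w - - z) * (- s - - t)"
      using 2 U ne gap by (intro subdiff_gap_pos[OF c True] reflect) auto
    then show ?thesis
      unfolding flip by (simp add: odd[OF U] algebra_simps)
  next
    case 3
    then show ?thesis using subdiff_gap_0_pos[OF c True] z w gap by simp
  next
    case 4
    then have U: "C = UNIV" using neg_mem s by simp
    have "(1 - c) * ((ederiv f (- s) - q) * (- s - 0)) < (- w - - z) * (- s - 0)"
      using 4 U gap reflect by (intro subdiff_gap_0_pos[OF c True]) auto
    then show ?thesis
      using 4 odd[OF U, of s] odd[OF U, of 0] by (simp add: algebra_simps)
  qed
qed

end

section \<open>From coordinates to vectors, and the contradiction with (BRSC)\<close>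

theorem theorem4p1:
  fixes C :: "real set" and A :: "real ^ 'n ^ 'm" and Y :: "real set" and y :: "real ^ 'm"
    and lam0 L C_K :: real
    and g :: "real \<Rightarrow> real \<Rightarrow> ereal" and \<psi> :: "'n \<Rightarrow> real \<Rightarrow> ereal"
    and K :: nat and X :: "(real ^ 'n) set" and x x' :: "real ^ 'n"
  assumes C: "C = UNIV \<or> C = {0..}"
    and y: "\<And>j. y $ j \<in> Y"
    and lam0: "lam0 > 0"
    and L: "L > 0"
    and g_nonneg: "\<And>j w. g (y $ j) w \<ge> 0"
    and g_proper: "\<And>j. proper (g (y $ j))"
    and g_convex: "\<And>j. strictly_convex (g (y $ j))"
    and g_coercive: "\<And>j. coercive_on UNIV (g (y $ j))"
    and g_diff2: "\<And>j. twice_differentiable_on (g (y $ j)) (interior (edom (g (y $ j))))"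
    and g_lipschitz: "\<And>j. L-lipschitz_on (interior (edom (g (y $ j)))) (ederiv (g (y $ j)))"
    and G_interior: "edom (data_term g y) \<noteq> UNIV \<Longrightarrow>
        closure ((\<lambda>u. A *v u) ` cart_power C) \<subseteq> interior (edom (data_term g y))"
    and G_grad_bounded: "edom (data_term g y) \<noteq> UNIV \<Longrightarrow>
        bdd_above ((\<lambda>w. norm (grad (data_term g y) w)) ` (\<lambda>u. A *v u) ` cart_power C)"
    and \<psi>_dom: "\<And>i. C \<subseteq> edom (\<psi> i)"
    and F_\<Psi>_interior: "cart_power C \<subseteq> interior (edom (\<lambda>u. data_term g y (A *v u))) \<inter>
        interior (edom (generating_fun \<psi>))"
    and \<psi>_proper: "\<And>i. proper (\<psi> i)"
    and \<psi>_convex: "\<And>i. strictly_convex (\<psi> i)"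
    and \<psi>_diff: "\<And>i t. t \<in> C \<Longrightarrow> val (\<psi> i) differentiable (at t)"
    and \<psi>_diff2: "\<And>i. twice_differentiable_on (\<psi> i) (interior C)"
    and \<psi>_coercive: "\<And>i. coercive_on C (\<lambda>t. ereal (ederiv (\<psi> i) t * t - val (\<psi> i) t))"
    and \<psi>_odd: "\<And>i t. C = UNIV \<Longrightarrow> ederiv (\<psi> i) (- t) = - ederiv (\<psi> i) t"
    and \<psi>_deriv_0: "\<And>i. C = {0..} \<Longrightarrow> ederiv (\<psi> i) 0 \<ge> 0"
    and K: "K \<le> CARD('n)"
    and X: "X \<subseteq> cart_power C"
    and C_K: "C_K > 0"
    and brsc: "BRSC C (\<lambda>u. data_term g y (A *v u)) (generating_fun \<psi>) X K C_K"
    and x: "x \<in> X" "critical_point C A g y lam0 \<psi> x"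
    and z: "\<And>i. let \<alpha> = threshold C lam0 (\<psi> i); z = dual_point A g y \<psi> x in
        \<bar>z $ i\<bar> \<notin> {C_K * (ederiv (\<psi> i) \<alpha> - ederiv (\<psi> i) 0) + ederiv (\<psi> i) 0 ..
                   (ederiv (\<psi> i) \<alpha> - ederiv (\<psi> i) 0) / C_K + ederiv (\<psi> i) 0}"
    and x': "critical_point C A g y lam0 \<psi> x'" "x' \<noteq> x"
  shows "l0norm (x' - x) > K"
proof (rule ccontr)
  assume "\<not> ?thesis"
  then have few: "l0norm (x - x') \<le> K"
    by (simp add: l0norm_def eq_commute[of "x $ _"] not_less)
  have gen: "generator C lam0 (\<psi> i)" for i
    using C lam0 \<psi>_dom \<psi>_proper \<psi>_convex \<psi>_diff \<psi>_diff2 \<psi>_coercive \<psi>_odd \<psi>_deriv_0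
    by unfold_locales auto
  have \<Psi>_eq: "generating_fun \<psi> = (\<lambda>u. \<Sum>i\<in>UNIV. \<psi> i (u $ i))"
    by (auto simp: generating_fun_def)
  have G_eq: "data_term g y = (\<lambda>w. \<Sum>j\<in>UNIV. g (y $ j) (w $ j))"
    by (auto simp: data_term_def)
  have grad_\<Psi>: "grad (generating_fun \<psi>) u = (\<chi> i. ederiv (\<psi> i) (u $ i))"
    if u: "u \<in> cart_power C" for u
    unfolding \<Psi>_eq using \<psi>_proper F_\<Psi>_interior u \<psi>_diff
    by (intro grad_eqI GDERIV_separable_sum) (auto simp: \<Psi>_eq cart_power_def)
  have val_\<Psi>: "val (generating_fun \<psi>) u = (\<Sum>i\<in>UNIV. val (\<psi> i) (u $ i))"
    if u: "u \<in> cart_power C" for u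
  proof -
    have "u \<in> edom (generating_fun \<psi>)"
      using F_\<Psi>_interior interior_subset u by blast
    then show ?thesis
      using \<psi>_proper val_separable_sum unfolding \<Psi>_eq by blast
  qed
  define GF where "GF u = transpose A *v grad (data_term g y) (A *v u)" for u
  have grad_F: "grad (\<lambda>u. data_term g y (A *v u)) u = GF u" if u: "u \<in> cart_power C" for u
  proof -
    \<comment> \<open>\<open>G_interior\<close> is available only for a proper subset as domain;
      otherwise the interior is the whole space.\<close>
    have int: "A *v u \<in> interior (edom (data_term g y))"
    proof (cases "edom (data_term g y) = UNIV")
      case False
      then show ?thesis
        using G_interior closure_subset u by blast
    qed simp
    have "val (g (y $ j)) differentiable at ((A *v u) $ j)" for j
      using g_diff2 interior_edom_component[of "\<lambda>j. g (y $ j)"] int g_proper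
      unfolding twice_differentiable_on_def G_eq by blast
    then have G: "GDERIV (val (data_term g y)) (A *v u) :> (\<chi> j. ederiv (g (y $ j)) ((A *v u) $ j))"
      unfolding G_eq using int g_proper by (intro GDERIV_separable_sum) (auto simp: G_eq)
    have "GDERIV (val (\<lambda>u. data_term g y (A *v u))) u :> GF u"
      using GDERIV_compose_matrix[OF G] grad_eqI[OF G] by (simp add: GF_def val_def[abs_def])
    then show ?thesis by (rule grad_eqI)
  qed
  have dual_component: "dual_point A g y \<psi> u $ i \<in> generator.subdiff C lam0 (\<psi> i) (u $ i)"
    if crit: "critical_point C A g y lam0 \<psi> u" for u i
    unfolding generator.subdiff_def[OF gen]
  proof safe
    fix t assume t: "t \<in> C"
    let ?z = "dual_point A g y \<psi> u" and ?h = "\<lambda>i. generator.h C lam0 (\<psi> i)"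
    have u: "u \<in> cart_power C" using crit by (simp add: critical_point_def)
    \<comment> \<open>This test point differs from \<open>u\<close> in coordinate \<open>i\<close>
      only, so all other summands cancel in the subgradient inequality.\<close>
    define v where "v = u + axis i (t - u $ i)"
    have v_i: "v $ i = t" and v_j: "\<And>j. j \<noteq> i \<Longrightarrow> v $ j = u $ j"
      by (auto simp: v_def axis_def)
    have v: "v \<in> cart_power C"
      unfolding cart_power_def
    proof safe
      fix j
      show "v $ j \<in> C"
        using u t v_i v_j[of j] by (cases "j = i") (auto simp: cart_power_def)
    qed
    have H: "relaxation C lam0 \<psi> w + val (generating_fun \<psi>) w = (\<Sum>j\<in>UNIV. ?h j (w $ j))"
      if "w \<in> cart_power C" for w
      using that by (simp add: relaxation_def val_\<Psi> generator.h_def[OF gen] sum.distrib)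
    have "(\<Sum>j\<in>UNIV. ?h j (u $ j)) + ?z \<bullet> (v - u) \<le> (\<Sum>j\<in>UNIV. ?h j (v $ j))"
      using crit v u unfolding critical_point_def subdifferential_on_def
      by (auto simp flip: H)
    moreover have "?z \<bullet> (v - u) = ?z $ i * (t - u $ i)"
      by (simp add: v_def inner_axis)
    moreover have "(\<Sum>j\<in>UNIV - {i}. ?h j (v $ j)) = (\<Sum>j\<in>UNIV - {i}. ?h j (u $ j))"
      using v_j by (intro sum.cong) auto
    ultimately show "?h i (u $ i) + ?z $ i * (t - u $ i) \<le> ?h i t"
      by (simp add: sum.remove[of UNIV i] v_i)
  qed
  let ?z = "dual_point A g y \<psi> x" and ?z' = "dual_point A g y \<psi> x'"
  let ?S = "\<lambda>i. (ederiv (\<psi> i) (x' $ i) - ederiv (\<psi> i) (x $ i)) * (x' $ i - x $ i)"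
  have mem: "x \<in> cart_power C" "x' \<in> cart_power C"
    using x x' by (auto simp: critical_point_def)
  have strict: "(1 - C_K) * ?S i < (?z' $ i - ?z $ i) * (x' $ i - x $ i)" if "x' $ i \<noteq> x $ i" for i
    using mem that z[of i] dual_component[OF x(2)] dual_component[OF x'(1)] C_K
    by (intro generator.subdiff_gap[OF gen])
      (auto simp: cart_power_def Let_def generator.a_def[OF gen])
  obtain i where i: "x' $ i \<noteq> x $ i"
    using x'(2) by (auto simp: vec_eq_iff)
  \<comment> \<open>Coordinates where \<open>x\<close> and \<open>x'\<close> agree contribute 0 to
    both sums; one differing coordinate makes the inequality strict.\<close>
  have "(\<Sum>i\<in>UNIV. (1 - C_K) * ?S i) < (\<Sum>i\<in>UNIV. (?z' $ i - ?z $ i) * (x' $ i - x $ i))"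
  proof (rule sum_strict_mono_ex1)
    show "\<forall>i\<in>UNIV. (1 - C_K) * ?S i \<le> (?z' $ i - ?z $ i) * (x' $ i - x $ i)"
    proof
      fix i
      show "(1 - C_K) * ?S i \<le> (?z' $ i - ?z $ i) * (x' $ i - x $ i)"
        using strict[of i] by (cases "x' $ i = x $ i") auto
    qed
  qed (use strict i in auto)
  moreover have "symm_bregman (generating_fun \<psi>) x x' = (\<Sum>i\<in>UNIV. ?S i)"
    by (simp add: symm_bregman_def grad_\<Psi> mem inner_vec_def)
  moreover have "(\<Sum>i\<in>UNIV. (?z' $ i - ?z $ i) * (x' $ i - x $ i)) = (?z' - ?z) \<bullet> (x' - x)"
    by (simp add: inner_vec_def)
  ultimately have "(1 - C_K) * symm_bregman (generating_fun \<psi>) x x' < (?z' - ?z) \<bullet> (x' - x)"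
    by (simp flip: sum_distrib_left)
  moreover have "(?z' - ?z) \<bullet> (x' - x) = symm_bregman (generating_fun \<psi>) x x'
      - symm_bregman (\<lambda>u. data_term g y (A *v u)) x x'"
    by (simp add: symm_bregman_def grad_F mem dual_point_def GF_def algebra_simps)
  moreover have "C_K * symm_bregman (generating_fun \<psi>) x x'
      \<le> symm_bregman (\<lambda>u. data_term g y (A *v u)) x x'"
    using brsc x(1) mem(2) x'(2) few by (auto simp: BRSC_def)
  ultimately show False by (simp add: algebra_simps)
qed

end
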